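(* Any deterministic terminating content-oblivious algorithm for leader election in rings with unique IDs sends at least $n\lfloor\log(\mathrm{ID}_{\max}/n)\rfloor$ messages (in the worst case over executions on rings of $n$ nodes whose IDs are at most $\mathrm{ID}_{\max}$).
   Context: Content-oblivious model: a ring of $n$ nodes, each with two ports, each connected by a channel to a neighbour; messages are content-free pulses; the network is asynchronous (arbitrary finite delays, no loss or injection); nodes are event-driven and act based only on their own ID and the sequence of pulses received so far (with the port of arrival). Algorithms are uniform (nodes do not know $n$). Nodes have unique IDs that are positive integers, $\mathrm{ID}_{\max}$ denotes the maximal ID. Leader election: every node terminates (enters a state where it ignores pulses and sends none) with output Leader or Non-Leader, exactly one node outputting Leader. Logarithms are binary. *)

theory Defs
  imports Complex_Main
begin

text \<open>
  Nodes of a ring of \<open>n\<close> nodes are \<open>0, \<dots>, n - 1\<close> in clockwise order; these indices are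
  invisible to the algorithm. A node has the two ports \<open>True\<close> and \<open>False\<close>.
\<close>

type_synonym port = bool

datatype verdict = Leader | Non_Leader

text \<open>
  A node sees only its ID and the ports on which it has received pulses so far, oldest first.
  For ID \<open>a\<close> and such a history \<open>h\<close>, \<open>sends A a h p\<close> is the number of pulses sent
  on port \<open>p\<close> in reaction to the last pulse of \<open>h\<close> (on start-up if \<open>h = []\<close>), and
  \<open>verdict A a h = Some v\<close> means that the node then terminates with output \<open>v\<close>.
  Since nothing else is an argument, algorithms are deterministic, content-oblivious and uniform.
\<close>

record algorithm =
  sends :: "nat \<Rightarrow> port list \<Rightarrow> port \<Rightarrow> nat"
  verdict :: "nat \<Rightarrow> port list \<Rightarrow> verdict option"

text \<open>
  \<open>cw i\<close> is the port of node \<open>i\<close> that leads to its clockwise neighbour. In an oriented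
  ring the port labels are consistent around the ring; otherwise they are arbitrary.
\<close>

datatype ring_kind = Oriented | Unoriented

fun port_labellings :: "ring_kind \<Rightarrow> (nat \<Rightarrow> port) set" where
  "port_labellings Oriented = {\<lambda>_. True}"
| "port_labellings Unoriented = UNIV"

text \<open>
  The node and port at which a pulse sent by node \<open>i\<close> on port \<open>p\<close> arrives. For
  \<open>n = 1\<close> the two ports of the node are connected to each other; for \<open>n = 2\<close> there
  are two parallel edges.
\<close>

definition link :: "nat \<Rightarrow> (nat \<Rightarrow> port) \<Rightarrow> nat \<times> port \<Rightarrow> nat \<times> port" where
  "link n cw = (\<lambda>(i, p).
     if p = cw i then let j = (i + 1) mod n in (j, \<not> cw j)
     else let j = (i + n - 1) mod n in (j, cw j))"

text \<open>
  Pulses are indistinguishable, so a channel is described by the number of pulses in transit;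
  \<open>transit c (i, p)\<close> counts those heading for port \<open>p\<close> of node \<open>i\<close>.
\<close>

record config =
  received :: "nat \<Rightarrow> port list"
  transit :: "nat \<times> port \<Rightarrow> nat"

definition emitted :: "nat \<Rightarrow> (nat \<Rightarrow> port) \<Rightarrow> nat \<Rightarrow> (port \<Rightarrow> nat) \<Rightarrow> nat \<times> port \<Rightarrow> nat" where
  "emitted n cw i s x = (\<Sum>p | link n cw (i, p) = x. s p)"

text \<open>
  All nodes have performed their start-up action. A later start of a node is indistinguishable
  from longer delays on its channels.
\<close>

definition init :: "algorithm \<Rightarrow> nat \<Rightarrow> (nat \<Rightarrow> port) \<Rightarrow> (nat \<Rightarrow> nat) \<Rightarrow> config" where
  "init A n cw ids =
     \<lparr>received = (\<lambda>_. []),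
      transit = (\<lambda>x. \<Sum>i<n. emitted n cw i (sends A (ids i) []) x)\<rparr>"

text \<open>A pulse delivered to a terminated node is consumed without any effect.\<close>

definition deliver ::
  "algorithm \<Rightarrow> nat \<Rightarrow> (nat \<Rightarrow> port) \<Rightarrow> (nat \<Rightarrow> nat) \<Rightarrow> nat \<times> port \<Rightarrow> config \<Rightarrow> config" where
  "deliver A n cw ids = (\<lambda>(i, p) c.
     let tr = (transit c)((i, p) := transit c (i, p) - 1)
     in if verdict A (ids i) (received c i) \<noteq> None then c\<lparr>transit := tr\<rparr>
        else let h = received c i @ [p]
             in \<lparr>received = (received c)(i := h),
                 transit = (\<lambda>x. tr x + emitted n cw i (sends A (ids i) h) x)\<rparr>)"

text \<open>
  At time \<open>t\<close> either one pulse is delivered (\<open>d t = Some x\<close>) or nothing happens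
  (\<open>d t = None\<close>). The last conjunct says that delays are finite: a nonempty channel is
  eventually served. As pulses are indistinguishable, they may be taken to leave a channel in
  FIFO order, so this means that every single pulse is eventually delivered.
\<close>

definition execution ::
  "algorithm \<Rightarrow> nat \<Rightarrow> (nat \<Rightarrow> port) \<Rightarrow> (nat \<Rightarrow> nat) \<Rightarrow> (nat \<Rightarrow> config) \<Rightarrow>
   (nat \<Rightarrow> (nat \<times> port) option) \<Rightarrow> bool" where
  "execution A n cw ids c d \<longleftrightarrow>
     c 0 = init A n cw ids \<and>
     (\<forall>t. case d t of
            None \<Rightarrow> c (Suc t) = c t
          | Some x \<Rightarrow> transit (c t) x > 0 \<and> c (Suc t) = deliver A n cw ids x (c t)) \<and>
     (\<forall>t x. transit (c t) x > 0 \<longrightarrow> (\<exists>t'\<ge>t. d t' = Some x))"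

definition valid_ids :: "nat \<Rightarrow> (nat \<Rightarrow> nat) \<Rightarrow> bool" where
  "valid_ids n ids \<longleftrightarrow> inj_on ids {..<n} \<and> (\<forall>i<n. ids i > 0)"

definition leader_elected :: "algorithm \<Rightarrow> nat \<Rightarrow> (nat \<Rightarrow> nat) \<Rightarrow> config \<Rightarrow> bool" where
  "leader_elected A n ids c \<longleftrightarrow>
     (\<forall>i<n. verdict A (ids i) (received c i) \<noteq> None) \<and>
     (\<exists>!i. i < n \<and> verdict A (ids i) (received c i) = Some Leader)"

definition solves_leader_election :: "ring_kind \<Rightarrow> algorithm \<Rightarrow> bool" where
  "solves_leader_election K A \<longleftrightarrow>
     (\<forall>n\<ge>1. \<forall>cw\<in>port_labellings K. \<forall>ids. valid_ids n ids \<longrightarrow>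
        (\<forall>c d. execution A n cw ids c d \<longrightarrow> (\<exists>t. leader_elected A n ids (c t))))"

text \<open>
  The number of pulses sent by all nodes until configuration \<open>c\<close> is reached: a node with
  history \<open>h\<close> has acted once for every prefix of \<open>h\<close>, including the empty one.
\<close>

definition messages_sent :: "algorithm \<Rightarrow> nat \<Rightarrow> (nat \<Rightarrow> nat) \<Rightarrow> config \<Rightarrow> nat" where
  "messages_sent A n ids c =
     (\<Sum>i<n. \<Sum>k\<le>length (received c i). \<Sum>p\<in>UNIV. sends A (ids i) (take k (received c i)) p)"

end

theory Submission
  imports Defs "HOL-Library.Countable"
begin

text \<open>
  Let a node with ID \<open>a\<close> run alone on the ring of size one; it becomes the leader after
  receiving pulses on some sequence of ports, its solitude pattern. If all IDs on a ring have
  solitude patterns with a common prefix, a round-robin scheduler can feed this prefix to every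
  node: what a node is about to receive from its neighbour is available because the neighbour
  sends what it would have sent alone. Hence solitude patterns are distinct, as otherwise a ring
  of two nodes would elect two leaders. By pigeonhole, among the patterns of \<open>ID_max\<close> IDs there
  are \<open>n\<close> that share a prefix of length \<open>\<lfloor>log 2 (ID_max / n)\<rfloor>\<close>.
\<close>

section \<open>Executions from schedules\<close>

text \<open>A schedule may name an empty channel, and the step is then idle. So any sequence of
  channels is a schedule, and its finite parts can be chosen freely.\<close>

primrec run ::
  "algorithm \<Rightarrow> nat \<Rightarrow> (nat \<Rightarrow> port) \<Rightarrow> (nat \<Rightarrow> nat) \<Rightarrow> (nat \<Rightarrow> nat \<times> port) \<Rightarrow> nat \<Rightarrow> config" where
  "run A n cw ids s 0 = init A n cw ids"
| "run A n cw ids s (Suc t) =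
     (if transit (run A n cw ids s t) (s t) > 0
      then deliver A n cw ids (s t) (run A n cw ids s t) else run A n cw ids s t)"

definition fair :: "(nat \<Rightarrow> 'a) \<Rightarrow> bool" where
  "fair s \<longleftrightarrow> (\<forall>x N. \<exists>t\<ge>N. s t = x)"

lemma run_cong: "(\<And>t. t < T \<Longrightarrow> s t = s' t) \<Longrightarrow> run A n cw ids s T = run A n cw ids s' T"
  by (induction T) simp_all

text \<open>With this, a proof only has to design the finitely many deliveries that it
  needs.\<close>

lemma fair_extension:
  fixes s :: "nat \<Rightarrow> 'a::countable"
  obtains s' where "fair s'" "\<And>t. t < T \<Longrightarrow> s' t = s t"
proof
  \<comment> \<open>Each pair is decoded from some time: its first component codes a value, and a
    large second component makes that time late.\<close>
  let ?s = "\<lambda>t. if t < T then s t else from_nat (fst (prod_decode t))"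
  show "fair ?s"
    unfolding fair_def
  proof (intro allI)
    fix x :: 'a and N
    let ?t = "prod_encode (to_nat x, N + T)"
    have "?t \<ge> N + T" by (rule le_prod_encode_2)
    then show "\<exists>t\<ge>N. ?s t = x" by (intro exI[of _ ?t]) simp
  qed
qed simp

lemma transit_deliver_other:
  "x \<noteq> y \<Longrightarrow> transit c x \<le> transit (deliver A n cw ids y c) x"
  by (cases y) (auto simp: deliver_def Let_def)

lemma received_deliver_terminated:
  "verdict A (ids i) (received c i) \<noteq> None \<Longrightarrow> received (deliver A n cw ids y c) i = received c i"
  by (cases y) (auto simp: deliver_def Let_def)

text \<open>A pulse can leave its channel only when that channel is scheduled. A fair schedule names
  the channel again, and it is still nonempty then.\<close>

lemma execution_run:
  assumes "fair s"
  shows "execution A n cw ids (run A n cw ids s)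
           (\<lambda>t. if transit (run A n cw ids s t) (s t) > 0 then Some (s t) else None)"
    (is "execution A n cw ids ?c ?d")
proof -
  have "\<exists>t'\<ge>t. ?d t' = Some x" if pos: "transit (?c t) x > 0" for t x
  proof (rule ccontr)
    assume never: "\<not> (\<exists>t'\<ge>t. ?d t' = Some x)"
    have stays: "transit (?c u) x > 0" if "t \<le> u" for u
      using that
    proof (induction u rule: dec_induct)
      case (step u)
      then have "s u \<noteq> x" using never by auto
      then show ?case
        using step.IH transit_deliver_other[of x "s u" "?c u" A n cw ids] by simp
    qed (rule pos)
    obtain u where "u \<ge> t" "s u = x" using assms unfolding fair_def by blast
    then show False using stays never by auto
  qed
  then show ?thesis unfolding execution_def by simp
qed

lemma received_run_terminated:
  assumes "verdict A (ids i) (received (run A n cw ids s t) i) \<noteq> None" "t \<le> u"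
  shows "received (run A n cw ids s u) i = received (run A n cw ids s t) i"
  using assms(2)
proof (induction u rule: dec_induct)
  case (step u)
  then show ?case
    using assms(1) received_deliver_terminated[of A ids i "run A n cw ids s u" n cw "s u"] by simp
qed simp

section \<open>Pulses in transit on the oriented ring\<close>

definition nbr :: "nat \<Rightarrow> nat \<Rightarrow> port \<Rightarrow> nat" where
  "nbr n i p = (if p then i + 1 else i + n - 1) mod n"

definition sent :: "algorithm \<Rightarrow> nat \<Rightarrow> port list \<Rightarrow> port \<Rightarrow> nat" where
  "sent A a h p = (\<Sum>k\<le>length h. sends A a (take k h) p)"

lemma sent_Nil: "sent A a [] p = sends A a [] p"
  by (simp add: sent_def)

lemma sent_snoc: "sent A a (h @ [q]) p = sent A a h p + sends A a (h @ [q]) p"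
  by (simp add: sent_def)

lemma nbr_less: "n \<ge> 1 \<Longrightarrow> nbr n i p < n"
  by (simp add: nbr_def)

lemma Suc_mod_eq_iff:
  fixes i j n :: nat
  assumes "i < n" "j < n"
  shows "(j + 1) mod n = i \<longleftrightarrow> j = (i + n - 1) mod n"
proof -
  have "(i + n - 1) mod n = (if i = 0 then n - 1 else i - 1)"
    using assms by (cases i) auto
  moreover have "(j + 1) mod n = (if j + 1 = n then 0 else j + 1)"
    using assms by auto
  ultimately show ?thesis
    using assms by (simp only: split: if_split) linarith
qed

text \<open>Inverting \<open>link\<close> reduces the sum in \<open>emitted\<close> to at most one
  term. Ports are tracked along with nodes, so rings of one or two nodes need no separate
  case.\<close>

lemma link_oriented_iff:
  assumes "j < n"
  shows "link n (\<lambda>_. True) (j, q) = (i, p) \<longleftrightarrow> i < n \<and> q = (\<not> p) \<and> j = nbr n i p"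
proof (cases "i < n")
  case True
  have eqs: "(j + 1) mod n = i \<longleftrightarrow> j = (i + n - 1) mod n"
      "(j + n - 1) mod n = i \<longleftrightarrow> j = (i + 1) mod n"
    using Suc_mod_eq_iff[OF True assms] Suc_mod_eq_iff[OF assms True] by metis+
  show ?thesis
    unfolding link_def nbr_def Let_def using True
    by (cases q; cases p) (simp_all only: eqs prod.case prod.inject if_True if_False simp_thms)
next
  case False
  moreover have "fst (link n (\<lambda>_. True) (j, q)) < n"
    using assms by (simp add: link_def Let_def)
  ultimately show ?thesis by auto
qed

lemma emitted_oriented:
  assumes "j < n"
  shows "emitted n (\<lambda>_. True) j s (i, p) = (if i < n \<and> j = nbr n i p then s (\<not> p) else 0)"
proof -
  have "{q. link n (\<lambda>_. True) (j, q) = (i, p)} = (if i < n \<and> j = nbr n i p then {\<not> p} else {})"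
    using assms by (auto simp: link_oriented_iff)
  then show ?thesis by (simp add: emitted_def)
qed

text \<open>
  Conservation of pulses. It breaks when a pulse is delivered to a terminated node, since the
  pulse is then not recorded in the history.
\<close>

definition consistent :: "algorithm \<Rightarrow> nat \<Rightarrow> (nat \<Rightarrow> nat) \<Rightarrow> config \<Rightarrow> bool" where
  "consistent A n ids c \<longleftrightarrow> (\<forall>i<n. \<forall>p. transit c (i, p) + count_list (received c i) p =
     sent A (ids (nbr n i p)) (received c (nbr n i p)) (\<not> p))"

lemma transit_init_oriented:
  assumes "n \<ge> 1"
  shows "transit (init A n (\<lambda>_. True) ids) (i, p) =
    (if i < n then sends A (ids (nbr n i p)) [] (\<not> p) else 0)"
proof -
  have "transit (init A n (\<lambda>_. True) ids) (i, p) =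
      (\<Sum>j<n. if i < n \<and> j = nbr n i p then sends A (ids j) [] (\<not> p) else 0)"
    by (simp add: init_def emitted_oriented)
  also have "\<dots> = (if i < n then sends A (ids (nbr n i p)) [] (\<not> p) else 0)"
    using nbr_less[OF assms, of i p] by auto
  finally show ?thesis .
qed

lemma consistent_init: "n \<ge> 1 \<Longrightarrow> consistent A n ids (init A n (\<lambda>_. True) ids)"
  by (simp add: consistent_def transit_init_oriented sent_Nil) (simp add: init_def sent_Nil)

lemma received_deliver:
  assumes "verdict A (ids i) (received c i) = None"
  shows "received (deliver A n cw ids (i, p) c) = (received c)(i := received c i @ [p])"
  using assms by (simp add: deliver_def Let_def)

text \<open>The delivered pulse moves from transit into the history of \<open>j\<close>, and the
  reaction of \<open>j\<close> adds equally to its outgoing channels and to \<open>sent\<close>. For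
  \<open>n = 1\<close> both effects can hit the same channel.\<close>

lemma consistent_deliver:
  assumes "consistent A n ids c" "j < n" "transit c (j, q) > 0"
    and "verdict A (ids j) (received c j) = None"
  shows "consistent A n ids (deliver A n (\<lambda>_. True) ids (j, q) c)"
proof -
  let ?c = "deliver A n (\<lambda>_. True) ids (j, q) c"
  have "transit ?c (i, p) + count_list (received ?c i) p =
      sent A (ids (nbr n i p)) (received ?c (nbr n i p)) (\<not> p)" if "i < n" for i p
  proof -
    have "transit ?c (i, p) = (if (i, p) = (j, q) then transit c (j, q) - 1 else transit c (i, p))
        + (if j = nbr n i p then sends A (ids j) (received c j @ [q]) (\<not> p) else 0)"
      using assms that by (simp add: deliver_def Let_def emitted_oriented)
    moreover have "count_list (received ?c i) p =
        count_list (received c i) p + (if (i, p) = (j, q) then 1 else 0)"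
      using assms by (simp add: received_deliver)
    moreover have "sent A (ids (nbr n i p)) (received ?c (nbr n i p)) (\<not> p) =
        sent A (ids (nbr n i p)) (received c (nbr n i p)) (\<not> p)
        + (if j = nbr n i p then sends A (ids j) (received c j @ [q]) (\<not> p) else 0)"
      using assms by (simp add: received_deliver sent_snoc)
    moreover have "transit c (i, p) + count_list (received c i) p =
        sent A (ids (nbr n i p)) (received c (nbr n i p)) (\<not> p)"
      using assms(1) that by (simp add: consistent_def)
    \<comment> \<open>Positivity of \<open>transit c (j, q)\<close> keeps the subtraction of 1 from
      truncating.\<close>
    ultimately show ?thesis using assms(3) by auto
  qed
  then show ?thesis by (simp add: consistent_def)
qed

text \<open>Schedules range over all naturals; this excludes deliveries to indices that are not
  nodes.\<close>

lemma transit_run_outside: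
  assumes "n \<ge> 1" "n \<le> i"
  shows "transit (run A n (\<lambda>_. True) ids s t) (i, p) = 0"
  using assms(2)
proof (induction t arbitrary: i p)
  case 0
  then show ?case using assms(1) by (simp add: transit_init_oriented)
next
  case (Suc t)
  obtain j q where st: "s t = (j, q)" by fastforce
  show ?case
  proof (cases "j < n")
    case True
    then show ?thesis using Suc by (auto simp: st deliver_def Let_def emitted_oriented)
  next
    case False
    then show ?thesis using Suc by (auto simp: st)
  qed
qed

section \<open>Histories of a solitary node\<close>

text \<open>On the ring of size one the two ports are joined, so a pulse can arrive on a port only
  if fewer have been received there than were sent on the other port. No run or schedule is
  mentioned, which lets such a history be replayed on larger rings.\<close>

definition solo_history :: "algorithm \<Rightarrow> nat \<Rightarrow> port list \<Rightarrow> bool" where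
  "solo_history A a h \<longleftrightarrow> (\<forall>k<length h. verdict A a (take k h) = None \<and>
     count_list (take k h) (h ! k) < sent A a (take k h) (\<not> h ! k))"

lemma solo_history_snoc:
  "solo_history A a (h @ [p]) \<longleftrightarrow>
     solo_history A a h \<and> verdict A a h = None \<and> count_list h p < sent A a h (\<not> p)"
  by (auto simp: solo_history_def less_Suc_eq nth_append)

lemma solo_history_take: "solo_history A a h \<Longrightarrow> solo_history A a (take k h)"
  by (auto simp: solo_history_def)

lemma solo_history_count_le_sent:
  "solo_history A a h \<Longrightarrow> count_list h p \<le> sent A a h (\<not> p)"
proof (induction h rule: rev_induct)
  case (snoc q h)
  then show ?case by (cases "p = q") (auto simp: solo_history_snoc sent_snoc)
qed simp

text \<open>Every pulse received alone was sent by the node itself. This turns the length of a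
  common prefix into a message count.\<close>

lemma length_le_sent:
  assumes "solo_history A a h"
  shows "length h \<le> (\<Sum>p\<in>UNIV. sent A a h p)"
proof -
  have "length h = count_list h True + count_list h False"
    by (induction h) auto
  also have "\<dots> \<le> sent A a h False + sent A a h True"
    using solo_history_count_le_sent[OF assms, of True] solo_history_count_le_sent[OF assms, of False]
    by simp
  finally show ?thesis by (simp add: UNIV_bool add.commute)
qed

text \<open>Conservation of pulses turns a nonempty channel into the strict inequality of
  \<open>solo_history\<close>. Consistency is claimed only before termination; afterwards the
  history is frozen.\<close>

lemma solo_history_run:
  fixes A :: algorithm and a :: nat and s :: "nat \<Rightarrow> nat \<times> port"
  defines "c \<equiv> run A 1 (\<lambda>_. True) (\<lambda>_. a) s"
  shows "solo_history A a (received (c t) 0) \<and>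
    (verdict A a (received (c t) 0) = None \<longrightarrow> consistent A 1 (\<lambda>_. a) (c t))"
proof (induction t)
  case 0
  show ?case
    using consistent_init[of 1] by (simp add: c_def solo_history_def) (simp add: init_def)
next
  case (Suc t)
  obtain j p where st: "s t = (j, p)" by fastforce
  show ?case
  proof (cases "transit (c t) (j, p) > 0 \<and> verdict A a (received (c t) 0) = None")
    case True
    then have j: "j = 0"
      using transit_run_outside[of 1 j A "\<lambda>_. a" s t p] by (cases j) (auto simp: c_def)
    have next_c: "c (Suc t) = deliver A 1 (\<lambda>_. True) (\<lambda>_. a) (0, p) (c t)"
      using True st j by (simp add: c_def)
    have cons: "consistent A 1 (\<lambda>_. a) (c t)"
      using Suc True by simp
    then have "transit (c t) (0, p) + count_list (received (c t) 0) p
        = sent A a (received (c t) 0) (\<not> p)"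
      by (simp add: consistent_def nbr_def)
    then have "count_list (received (c t) 0) p < sent A a (received (c t) 0) (\<not> p)"
      using True j by simp
    then show ?thesis
      using Suc True j cons
      by (auto simp: next_c received_deliver solo_history_snoc intro!: consistent_deliver)
  next
    case False
    show ?thesis
    proof (cases "transit (c t) (j, p) > 0")
      case True
      with False have "received (c (Suc t)) 0 = received (c t) 0"
        using st received_deliver_terminated[of A "\<lambda>_. a" 0 "c t"] by (simp add: c_def)
      then show ?thesis using Suc False True by auto
    next
      case False
      then have "c (Suc t) = c t" using st by (simp add: c_def)
      then show ?thesis using Suc by simp
    qed
  qed
qed

text \<open>Executions on the oriented ring thus serve for both kinds of ring.\<close>

lemma oriented_labelling: "(\<lambda>_. True) \<in> port_labellings K"
  by (cases K) simp_all

lemma solo_leader_history: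
  assumes "solves_leader_election K A" "a > 0"
  obtains h where "solo_history A a h" "verdict A a h = Some Leader"
proof -
  obtain s :: "nat \<Rightarrow> nat \<times> port" where "fair s"
    by (rule fair_extension)
  then have "execution A 1 (\<lambda>_. True) (\<lambda>_. a) (run A 1 (\<lambda>_. True) (\<lambda>_. a) s)
      (\<lambda>t. if transit (run A 1 (\<lambda>_. True) (\<lambda>_. a) s t) (s t) > 0 then Some (s t) else None)"
    by (rule execution_run)
  moreover have "valid_ids 1 (\<lambda>_. a)"
    using assms(2) by (simp add: valid_ids_def inj_on_def)
  ultimately obtain t where "leader_elected A 1 (\<lambda>_. a) (run A 1 (\<lambda>_. True) (\<lambda>_. a) s t)"
    using assms(1) oriented_labelling[of K] unfolding solves_leader_election_def by blast
  then have "verdict A a (received (run A 1 (\<lambda>_. True) (\<lambda>_. a) s t) 0) = Some Leader"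
    by (auto simp: leader_elected_def)
  then show ?thesis
    using that solo_history_run by blast
qed

section \<open>Feeding a common solo history to all nodes\<close>

text \<open>The outer induction adds one pulse to the common history, the inner one hands it to the
  nodes in turn. Consistency is carried along to show that the pulse is available.\<close>

lemma run_common_history_consistent:
  assumes "n \<ge> 1" "\<And>i. i < n \<Longrightarrow> solo_history A (ids i) g"
  shows "\<exists>s T. consistent A n ids (run A n (\<lambda>_. True) ids s T) \<and>
    (\<forall>i<n. received (run A n (\<lambda>_. True) ids s T) i = g)"
  using assms(2)
proof (induction g rule: rev_induct)
  case Nil
  show ?case
    using assms(1) by (intro exI[of _ "\<lambda>_. (0, True)"] exI[of _ 0])
      (simp add: consistent_init, simp add: init_def)
next
  case (snoc p g)
  have solo: "solo_history A (ids i) g" "verdict A (ids i) g = None"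
      "count_list g p < sent A (ids i) g (\<not> p)" if "i < n" for i
    using snoc.prems[OF that] by (auto simp: solo_history_snoc)
  have "\<exists>s T. consistent A n ids (run A n (\<lambda>_. True) ids s T) \<and>
      (\<forall>i<n. received (run A n (\<lambda>_. True) ids s T) i = (if i < m then g @ [p] else g))"
    if "m \<le> n" for m
    using that
  proof (induction m)
    case 0
    then show ?case using snoc.IH solo(1) by simp
  next
    case (Suc m)
    then obtain s T where cons: "consistent A n ids (run A n (\<lambda>_. True) ids s T)"
      and recv: "\<And>i. i < n \<Longrightarrow> received (run A n (\<lambda>_. True) ids s T) i =
        (if i < m then g @ [p] else g)"
      by auto
    define c where "c = run A n (\<lambda>_. True) ids s T"
    let ?j = "nbr n m p"
    have m: "m < n" and j: "?j < n" using Suc.prems assms(1) nbr_less by auto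
    \<comment> \<open>The neighbour may already have received its copy of \<open>p\<close>, but
      \<open>sent\<close> only grows with the history, so the bound from its own solo history
      persists.\<close>
    have "count_list g p < sent A (ids ?j) (received c ?j) (\<not> p)"
      using solo(3)[OF j] recv[OF j] by (simp add: c_def sent_snoc)
    moreover have "transit c (m, p) + count_list (received c m) p =
        sent A (ids ?j) (received c ?j) (\<not> p)"
      using cons m unfolding c_def consistent_def by blast
    moreover have "received c m = g"
      using recv[OF m] by (simp add: c_def)
    ultimately have pos: "transit c (m, p) > 0" by simp
    have live: "verdict A (ids m) (received c m) = None"
      using solo(2)[OF m] recv[OF m] by (simp add: c_def)
    have c_upd: "run A n (\<lambda>_. True) ids (s(T := (m, p))) T = c"
      unfolding c_def by (rule run_cong) simp
    have "run A n (\<lambda>_. True) ids (s(T := (m, p))) (Suc T) = deliver A n (\<lambda>_. True) ids (m, p) c"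
      using pos by (simp add: c_upd)
    moreover have "consistent A n ids (deliver A n (\<lambda>_. True) ids (m, p) c)"
      using cons m pos live by (simp add: c_def consistent_deliver)
    moreover have "received (deliver A n (\<lambda>_. True) ids (m, p) c) i =
        (if i < Suc m then g @ [p] else g)" if "i < n" for i
      using recv[OF that] recv[OF m] received_deliver[of A ids m c, OF live]
      by (auto simp: c_def less_Suc_eq)
    ultimately show ?case by metis
  qed
  from this[of n] show ?case by auto
qed

lemma run_common_history:
  assumes "n \<ge> 1" "\<And>i. i < n \<Longrightarrow> solo_history A (ids i) g"
  obtains s T where "fair s" "\<And>i. i < n \<Longrightarrow> received (run A n (\<lambda>_. True) ids s T) i = g"
proof -
  obtain s T where recv: "\<And>i. i < n \<Longrightarrow> received (run A n (\<lambda>_. True) ids s T) i = g"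
    using run_common_history_consistent[of n A ids g] assms by blast
  obtain s' where "fair s'" "\<And>t. t < T \<Longrightarrow> s' t = s t"
    using fair_extension[of T s] by blast
  then show ?thesis
    using that recv run_cong[of T s' s A n "\<lambda>_. True" ids] by metis
qed

lemma solo_leader_history_inj:
  assumes "solves_leader_election K A" "a > 0" "b > 0"
    and "solo_history A a g" "verdict A a g = Some Leader"
    and "solo_history A b g" "verdict A b g = Some Leader"
  shows "a = b"
proof (rule ccontr)
  assume "a \<noteq> b"
  define ids where "ids i = (if i = 0 then a else b)" for i :: nat
  have solo: "solo_history A (ids i) g" for i
    using assms by (simp add: ids_def)
  obtain s T where fair: "fair s"
    and "\<And>i. i < 2 \<Longrightarrow> received (run A 2 (\<lambda>_. True) ids s T) i = g"
    using run_common_history[of 2 A ids g] solo by (metis one_le_numeral)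
  then have both: "verdict A (ids i) (received (run A 2 (\<lambda>_. True) ids s T) i) = Some Leader"
    if "i < 2" for i
    using that assms by (simp add: ids_def)
  have "valid_ids 2 ids"
    using \<open>a \<noteq> b\<close> assms by (auto simp: valid_ids_def inj_on_def ids_def)
  then obtain t where t: "leader_elected A 2 ids (run A 2 (\<lambda>_. True) ids s t)"
    using assms(1) oriented_labelling[of K] execution_run[OF fair, of A 2 "\<lambda>_. True" ids]
      one_le_numeral unfolding solves_leader_election_def by blast
  \<comment> \<open>The time \<open>t\<close> of the election need not be \<open>T\<close>. Both
    nodes have terminated at both times, so their histories agree whichever comes first.\<close>
  have same: "received (run A 2 (\<lambda>_. True) ids s t) i = received (run A 2 (\<lambda>_. True) ids s T) i"
    if "i < 2" for i
  proof (cases "t \<le> T")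
    case True
    then show ?thesis
      using t that by (intro received_run_terminated[symmetric]) (auto simp: leader_elected_def)
  next
    case False
    then show ?thesis
      using both[OF that] by (intro received_run_terminated) auto
  qed
  have "verdict A (ids i) (received (run A 2 (\<lambda>_. True) ids s t) i) = Some Leader" if "i < 2" for i
    using both[OF that] same[OF that] by simp
  from this[of 0] this[of 1] have "\<not> leader_elected A 2 ids (run A 2 (\<lambda>_. True) ids s t)"
    unfolding leader_elected_def by (metis less_2_cases_iff One_nat_def zero_neq_one)
  with t show False by contradiction
qed

section \<open>Common prefixes among distinct strings\<close>

lemma card_bool_lists_length_less: "card {xs :: bool list. length xs < s} < 2 ^ s"
proof (cases s)
  case (Suc m)
  have "card {xs :: bool list. length xs < s} = (\<Sum>i\<le>m. 2 ^ i)"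
    using card_lists_length_le[of "UNIV :: bool set" m] by (simp add: Suc less_Suc_eq_le)
  also have "\<dots> = 2 ^ s - 1"
    using sum_power2[of s] by (simp add: Suc lessThan_Suc_atMost atLeast0LessThan)
  finally show ?thesis by simp
qed simp

text \<open>By injectivity fewer than \<open>2 ^ s\<close> elements have strings shorter than
  \<open>s\<close>. The others fall into \<open>2 ^ s\<close> classes; with at most
  \<open>n - 1\<close> in each, the total would stay below \<open>n * 2 ^ s\<close>.\<close>

lemma common_prefix:
  fixes P :: "'a \<Rightarrow> bool list"
  assumes "finite X" "inj_on P X" "n * 2 ^ s \<le> card X"
  obtains S g where "S \<subseteq> X" "card S = n" "\<And>a. a \<in> S \<Longrightarrow> take s (P a) = g" "length g = s"
proof -
  define F :: "bool list set" where "F = {g. length g = s}"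
  define C where "C g = {a \<in> X. s \<le> length (P a) \<and> take s (P a) = g}" for g
  have F: "finite F" "card F = 2 ^ s"
    using finite_lists_length_eq[of "UNIV :: bool set" s] card_lists_length_eq[of "UNIV :: bool set" s]
    by (simp_all add: F_def)
  have "\<exists>g\<in>F. n \<le> card (C g)"
  proof (rule ccontr)
    assume "\<not> ?thesis"
    \<comment> \<open>The spare 1 in each class, summed over \<open>F\<close>, pays for the short
      strings.\<close>
    then have small: "card (C g) + 1 \<le> n" if "g \<in> F" for g
      using that by force
    have fin_short: "finite {xs :: bool list. length xs < s}"
      by (rule finite_subset[OF _ finite_lists_length_le[of "UNIV :: bool set" s]]) auto
    have "card {a \<in> X. length (P a) < s} \<le> card {xs :: bool list. length xs < s}"
      using assms(2) by (intro card_inj_on_le[of P] fin_short) (auto intro: inj_on_subset)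
    also have "\<dots> < 2 ^ s" by (rule card_bool_lists_length_less)
    finally have short: "card {a \<in> X. length (P a) < s} < 2 ^ s" .
    have "X = {a \<in> X. length (P a) < s} \<union> (\<Union>g\<in>F. C g)"
      by (auto simp: C_def F_def)
    then have "card X \<le> card {a \<in> X. length (P a) < s} + card (\<Union>g\<in>F. C g)"
      by (metis card_Un_le)
    also have "card (\<Union>g\<in>F. C g) \<le> (\<Sum>g\<in>F. card (C g))"
      by (rule card_UN_le[OF F(1)])
    finally have "card X < 2 ^ s + (\<Sum>g\<in>F. card (C g))" using short by simp
    also have "\<dots> = (\<Sum>g\<in>F. card (C g) + 1)"
      unfolding sum.distrib by (simp add: F)
    also have "\<dots> \<le> n * 2 ^ s"
      using sum_mono[of F "\<lambda>g. card (C g) + 1" "\<lambda>_. n"] small by (simp add: F mult.commute)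
    finally show False using assms(3) by simp
  qed
  then obtain g where "g \<in> F" "n \<le> card (C g)" by blast
  moreover then obtain S where "S \<subseteq> C g" "card S = n"
    by (meson obtain_subset_with_card_n)
  ultimately show ?thesis
    using that[of S g] by (auto simp: C_def F_def)
qed

section \<open>Choice of the IDs and the message count\<close>

theorem theorem1p3:
  fixes A :: algorithm and K :: ring_kind and n ID_max :: nat
  assumes "solves_leader_election K A"
    and "1 \<le> n" and "n \<le> ID_max"
  shows "\<exists>ids. valid_ids n ids \<and> (\<forall>i<n. ids i \<le> ID_max) \<and>
           (\<exists>cw\<in>port_labellings K. \<exists>c d. execution A n cw ids c d \<and>
              (\<exists>t. int (messages_sent A n ids (c t))
                     \<ge> int n * \<lfloor>log 2 (real ID_max / real n)\<rfloor>))"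
proof -
  define r where "r = nat \<lfloor>log 2 (real ID_max / real n)\<rfloor>"
  have "log 2 (real ID_max / real n) \<ge> 0"
    using assms(2,3) by simp
  then have r: "int r = \<lfloor>log 2 (real ID_max / real n)\<rfloor>"
    by (simp add: r_def)
  \<comment> \<open>Rounding down gives \<open>n * 2 ^ r \<le> ID_max\<close>, the size that the
    pigeonhole argument asks for.\<close>
  have "2 powr real r \<le> 2 powr log 2 (real ID_max / real n)"
    using r by (intro powr_mono) linarith+
  also have "\<dots> = real ID_max / real n"
    using assms(2,3) by simp
  finally have "real (n * 2 ^ r) \<le> real ID_max"
    using assms(2) by (simp add: powr_realpow field_simps)
  then have count: "n * 2 ^ r \<le> card {1..ID_max}"
    unfolding of_nat_le_iff by simp
  have "\<exists>h. solo_history A a h \<and> verdict A a h = Some Leader" if "a > 0" for a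
    using solo_leader_history[OF assms(1) that] by blast
  \<comment> \<open>A solitary node may have several such histories, depending on the schedule;
    \<open>P\<close> fixes one per ID.\<close>
  then obtain P where P: "\<And>a. a > 0 \<Longrightarrow> solo_history A a (P a)"
      "\<And>a. a > 0 \<Longrightarrow> verdict A a (P a) = Some Leader"
    by metis
  have "inj_on P {1..ID_max}"
  proof (rule inj_onI)
    fix a b assume "a \<in> {1..ID_max}" "b \<in> {1..ID_max}" "P a = P b"
    then show "a = b"
      using solo_leader_history_inj[OF assms(1), of a b "P a"] P[of a] P[of b] by simp
  qed
  then obtain S g where S: "S \<subseteq> {1..ID_max}" "card S = n"
    and g: "\<And>a. a \<in> S \<Longrightarrow> take r (P a) = g" "length g = r"
    using common_prefix[of "{1..ID_max}" P n r] count by auto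
  have "finite S" using S(1) finite_subset by blast
  then obtain ids where ids: "bij_betw ids {..<n} S"
    using ex_bij_betw_nat_finite[of S] S(2) by (auto simp: atLeast0LessThan)
  have mem: "ids i \<in> S" if "i < n" for i
    using ids that by (auto dest: bij_betwE)
  have pos: "ids i > 0" "ids i \<le> ID_max" if "i < n" for i
    using mem[OF that] S(1) by auto
  have solo: "solo_history A (ids i) g" if "i < n" for i
    using g(1)[OF mem[OF that]] solo_history_take[OF P(1)[OF pos(1)[OF that]], of r] by simp
  obtain s T where "fair s"
    and recv: "\<And>i. i < n \<Longrightarrow> received (run A n (\<lambda>_. True) ids s T) i = g"
    using run_common_history[of n A ids g] assms(2) solo by blast
  have "messages_sent A n ids (run A n (\<lambda>_. True) ids s T) =
      (\<Sum>i<n. \<Sum>p\<in>UNIV. sent A (ids i) g p)"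
    unfolding messages_sent_def sent_def using recv by (simp add: sum.swap[of _ UNIV])
  \<comment> \<open>At time \<open>T\<close> each node has history \<open>g\<close> of length
    \<open>r\<close>, hence has sent at least \<open>r\<close> pulses.\<close>
  also have "\<dots> \<ge> (\<Sum>i<n. r)"
    using length_le_sent[OF solo] g(2) by (intro sum_mono) auto
  finally have "n * r \<le> messages_sent A n ids (run A n (\<lambda>_. True) ids s T)"
    by simp
  then have "int n * int r \<le> int (messages_sent A n ids (run A n (\<lambda>_. True) ids s T))"
    unfolding of_nat_mult[symmetric] of_nat_le_iff .
  moreover have "valid_ids n ids"
    using ids pos by (auto simp: valid_ids_def bij_betw_def)
  ultimately show ?thesis
    using pos(2) execution_run[OF \<open>fair s\<close>, of A n "\<lambda>_. True" ids] oriented_labelling[of K]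
    unfolding r by blast
qed

end
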